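(* Let $f:(X,d)\to(Y,\rho)$ be a function between two metric spaces. Then the following are equivalent. (a) $f$ is Cauchy-continuous. (b) $f$ is TB-regular and the set of subsets of $X$ on which $f$ is Cauchy-continuous is closed under finite unions. (c) $f$ is TB-regular and the set of subsets of $X$ on which $f$ is Cauchy-continuous forms a bornology.
   Context: A subset $A$ of a metric space $(X,d)$ is totally bounded if for every $\epsilon>0$ there is a finite set $\{x_1,\dots,x_n\}\subseteq X$ with $A\subseteq\bigcup_{i=1}^n B(x_i,\epsilon)$, where $B(x,\epsilon)$ is the open ball. A (not necessarily continuous) function $f:(X,d)\to(Y,\rho)$ is TB-regular if $f(A)$ is totally bounded for every totally bounded subset $A$ of $X$. It is Cauchy-continuous if $(f(x_n))$ is Cauchy in $(Y,\rho)$ for every Cauchy sequence $(x_n)$ in $(X,d)$; it is Cauchy-continuous on a subset $A\subseteq X$ if the restriction $f|_A$ (with $A$ carrying the metric of $X$) is Cauchy-continuous. A bornology on $X$ is a family $\mathbf{B}$ of non-empty subsets of $X$ that (i) covers $X$, (ii) is hereditary: if $A\in\mathbf{B}$ and $\emptyset\neq B\subseteq A$ then $B\in\mathbf{B}$, and (iii) is closed under finite unions. The subsets of $X$ considered here are non-empty. *)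

theory Defs
  imports "HOL-Analysis.Analysis"
begin

abbreviation totally_bounded_in :: "'a metric \<Rightarrow> 'a set \<Rightarrow> bool" where
  "totally_bounded_in X \<equiv> Metric_space.mtotally_bounded (mspace X) (mdist X)"

text \<open>The library definition takes the centres of the covering balls in the set itself;
  the following shows that they may equivalently be taken anywhere in the ambient space.\<close>

lemma totally_bounded_in_iff_ambient_centres:
  "totally_bounded_in X A \<longleftrightarrow>
     A \<subseteq> mspace X \<and>
     (\<forall>\<epsilon>>0. \<exists>K. finite K \<and> K \<subseteq> mspace X \<and>
        A \<subseteq> (\<Union>x\<in>K. Metric_space.mball (mspace X) (mdist X) x \<epsilon>))"
  (is "?L \<longleftrightarrow> ?R")
proof -
  interpret Metric_space "mspace X" "mdist X"
    by (rule Metric_space_mspace_mdist)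
  show ?thesis
  proof
    assume L: ?L
    then have "A \<subseteq> mspace X"
      by (rule mtotally_bounded_imp_subset)
    with L show ?R
      unfolding mtotally_bounded_def by (meson order_trans)
  next
    assume R: ?R
    show ?L
      unfolding mtotally_bounded_def
    proof (intro allI impI)
      fix e :: real assume "e > 0"
      then obtain K where K: "finite K" "A \<subseteq> (\<Union>x\<in>K. mball x (e/2))"
        using R by (meson half_gt_zero)
      define c where "c x = (SOME a. a \<in> A \<inter> mball x (e/2))" for x
      define K' where "K' = {x \<in> K. A \<inter> mball x (e/2) \<noteq> {}}"
      have c: "c x \<in> A \<inter> mball x (e/2)" if "x \<in> K'" for x
        using that unfolding K'_def c_def by (metis (mono_tags, lifting) ex_in_conv mem_Collect_eq someI_ex)
      have "A \<subseteq> (\<Union>x\<in>c ` K'. mball x e)"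
      proof
        fix a assume a: "a \<in> A"
        then obtain x where x: "x \<in> K" "a \<in> mball x (e/2)"
          using K by blast
        then have "x \<in> K'"
          using a by (auto simp: K'_def)
        then have cx: "c x \<in> mspace X" "mdist X x (c x) < e/2"
          using c[of x] by auto
        have "mdist X (c x) a \<le> mdist X (c x) x + mdist X x a"
          using cx x by (intro triangle) auto
        also have "\<dots> < e"
          using cx x commute[of "c x" x] by auto
        finally show "a \<in> (\<Union>x\<in>c ` K'. mball x e)"
          using cx x \<open>x \<in> K'\<close> by auto
      qed
      moreover have "finite (c ` K')" "c ` K' \<subseteq> A"
        using K c by (auto simp: K'_def)
      ultimately show "\<exists>K. finite K \<and> K \<subseteq> A \<and> A \<subseteq> (\<Union>x\<in>K. mball x e)"
        by blast
    qed
  qed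
qed

definition TB_regular :: "'a metric \<Rightarrow> 'b metric \<Rightarrow> ('a \<Rightarrow> 'b) \<Rightarrow> bool" where
  "TB_regular X Y f \<longleftrightarrow>
     (\<forall>A. A \<subseteq> mspace X \<longrightarrow> totally_bounded_in X A \<longrightarrow> totally_bounded_in Y (f ` A))"

definition Cauchy_continuity_sets :: "'a metric \<Rightarrow> 'b metric \<Rightarrow> ('a \<Rightarrow> 'b) \<Rightarrow> 'a set set" where
  "Cauchy_continuity_sets X Y f =
     {A. A \<noteq> {} \<and> A \<subseteq> mspace X \<and> Cauchy_continuous_map (submetric X A) Y f}"

text \<open>Only non-empty finite subfamilies are considered, since the families at hand consist of
  non-empty sets and so never contain the empty union.\<close>

definition closed_under_finite_unions :: "'a set set \<Rightarrow> bool" where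
  "closed_under_finite_unions \<B> \<longleftrightarrow>
     (\<forall>\<F>. finite \<F> \<longrightarrow> \<F> \<noteq> {} \<longrightarrow> \<F> \<subseteq> \<B> \<longrightarrow> \<Union>\<F> \<in> \<B>)"

definition bornology_on :: "'a set \<Rightarrow> 'a set set \<Rightarrow> bool" where
  "bornology_on S \<B> \<longleftrightarrow>
     (\<forall>A\<in>\<B>. A \<noteq> {} \<and> A \<subseteq> S) \<and>
     \<Union>\<B> = S \<and>
     (\<forall>A B. A \<in> \<B> \<longrightarrow> B \<noteq> {} \<longrightarrow> B \<subseteq> A \<longrightarrow> B \<in> \<B>) \<and>
     closed_under_finite_unions \<B>"

end

theory Submission
  imports Defs
begin

text \<open>
  If \<open>f\<close> is Cauchy-continuous, it is Cauchy-continuous on every non-empty subset, so the family in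
  question consists of all non-empty subsets of \<open>X\<close> and is a bornology. Moreover \<open>f\<close> is TB-regular,
  because total boundedness of a set means that its sequences have Cauchy subsequences. A bornology
  is closed under finite unions by definition, so the content lies in deducing Cauchy-continuity
  from TB-regularity and closure under finite unions.

  The range of a Cauchy sequence is totally bounded, so TB-regularity gives every Cauchy sequence
  \<open>\<sigma>\<close> a subsequence whose image under \<open>f\<close> is Cauchy. This does not make \<open>f\<close> Cauchy-continuous on
  the range of the subsequence: if one of the terms happens to be the limit of \<open>\<sigma>\<close>, then \<open>f\<close> may
  jump there. This is the only obstruction (\<open>range_in_Cauchy_continuity_sets\<close>), since otherwise a
  Cauchy sequence in the range either runs off along \<open>\<sigma>\<close> or is eventually constant
  (\<open>MCauchy_reindex_dichotomy\<close>). The point of closure under finite unions is to compare two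
  sequences: if \<open>f\<close> is Cauchy-continuous on the union of the ranges of two asymptotic Cauchy
  sequences, then it can be applied to their interleaving, so that their images are asymptotic too.
  Hence two asymptotic Cauchy sequences, each of them constant or without a term equal to its limit,
  cannot have images that stay a fixed distance apart (\<open>asymptotic_images_not_apart\<close>).

  Now let \<open>\<sigma>\<close> be Cauchy. If it has a limit \<open>a\<close> in \<open>X\<close> and \<open>f \<circ> \<sigma>\<close> does not tend to \<open>f a\<close>, the
  terms whose images stay away from \<open>f a\<close> differ from \<open>a\<close>, and they can be compared with the
  constant sequence \<open>a\<close>. If \<open>\<sigma>\<close> has no limit in \<open>X\<close>, neither has any reindexing of it
  that tends to infinity, and a failure of the Cauchy condition for \<open>f \<circ> \<sigma>\<close> yields two such
  reindexings with images a fixed distance apart.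
\<close>

section \<open>Cauchy sequences and reindexing\<close>

context Metric_space
begin

lemma MCauchy_reindex:
  assumes "MCauchy \<sigma>" "filterlim k at_top sequentially"
  shows "MCauchy (\<sigma> \<circ> k)"
  unfolding MCauchy_def
proof (intro conjI strip)
  show "range (\<sigma> \<circ> k) \<subseteq> M"
    using assms(1) by (auto simp: MCauchy_def)
  fix \<epsilon> :: real assume "\<epsilon> > 0"
  then obtain N where N: "\<And>n n'. \<lbrakk>N \<le> n; N \<le> n'\<rbrakk> \<Longrightarrow> d (\<sigma> n) (\<sigma> n') < \<epsilon>"
    using assms(1) unfolding MCauchy_def by meson
  obtain P where "\<And>n. P \<le> n \<Longrightarrow> N \<le> k n"
    using assms(2) by (auto simp: filterlim_at_top eventually_sequentially)
  with N show "\<exists>P. \<forall>n n'. P \<le> n \<longrightarrow> P \<le> n' \<longrightarrow> d ((\<sigma> \<circ> k) n) ((\<sigma> \<circ> k) n') < \<epsilon>"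
    by (metis comp_apply)
qed

lemma MCauchy_reindex_dist:
  assumes "MCauchy \<sigma>" "filterlim p at_top sequentially" "filterlim q at_top sequentially"
  shows "(\<lambda>n. d (\<sigma> (p n)) (\<sigma> (q n))) \<longlonglongrightarrow> 0"
proof (rule LIMSEQ_I)
  fix \<epsilon> :: real assume "\<epsilon> > 0"
  then obtain N where N: "\<And>n n'. \<lbrakk>N \<le> n; N \<le> n'\<rbrakk> \<Longrightarrow> d (\<sigma> n) (\<sigma> n') < \<epsilon>"
    using assms(1) unfolding MCauchy_def by meson
  have "\<forall>\<^sub>F n in sequentially. N \<le> p n \<and> N \<le> q n"
    using assms by (simp add: filterlim_at_top eventually_conj)
  then show "\<exists>no. \<forall>n\<ge>no. norm (d (\<sigma> (p n)) (\<sigma> (q n)) - 0) < \<epsilon>"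
    using N by (auto simp: eventually_sequentially)
qed

lemma MCauchy_eventually_const:
  assumes "range \<sigma> \<subseteq> M" "\<forall>\<^sub>F n in sequentially. \<sigma> n = c"
  shows "MCauchy \<sigma>"
proof -
  obtain N where N: "\<And>n. n \<ge> N \<Longrightarrow> \<sigma> n = c"
    using assms(2) by (auto simp: eventually_sequentially)
  then have "c \<in> M" using assms(1) by blast
  with N assms(1) show ?thesis
    unfolding MCauchy_def by (metis mdist_zero)
qed

text \<open>
  Unlike a subsequence, a reindexing that merely tends to infinity may repeat terms and need not be
  increasing; such index functions come directly from a choice of \<open>k n \<ge> n\<close> for each \<open>n\<close>.
\<close>

lemma MCauchy_reindex_limit:
  assumes "MCauchy \<sigma>" "filterlim k at_top sequentially"
    and lim: "limitin mtopology (\<sigma> \<circ> k) l sequentially"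
  shows "limitin mtopology \<sigma> l sequentially"
proof -
  have M: "range \<sigma> \<subseteq> M" and l: "l \<in> M"
    using assms by (auto simp: MCauchy_def limitin_metric)
  have "(\<lambda>n. d (\<sigma> n) (\<sigma> (k n)) + d (\<sigma> (k n)) l) \<longlonglongrightarrow> 0 + 0"
    using MCauchy_reindex_dist[OF assms(1) filterlim_ident assms(2)] lim
    by (intro tendsto_add) (auto simp: limitin_metric_dist_null o_def)
  then have "(\<lambda>n. d (\<sigma> n) (\<sigma> (k n)) + d (\<sigma> (k n)) l) \<longlonglongrightarrow> 0"
    by simp
  moreover have "\<forall>\<^sub>F n in sequentially.
      norm (d (\<sigma> n) l) \<le> d (\<sigma> n) (\<sigma> (k n)) + d (\<sigma> (k n)) l"
    using M l by (intro always_eventually allI) (simp add: image_subset_iff triangle)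
  ultimately have "(\<lambda>n. d (\<sigma> n) l) \<longlonglongrightarrow> 0"
    by (rule Lim_null_comparison[rotated])
  then show ?thesis
    using M l by (auto simp: limitin_metric_dist_null image_subset_iff)
qed

text \<open>
  If \<open>k\<close> does not tend to infinity, it takes some value \<open>j\<close> infinitely often, so \<open>\<sigma> \<circ> k\<close> tends to
  \<open>\<sigma> j\<close>. Either \<open>\<sigma> \<circ> k\<close> stays eventually within finitely many terms of \<open>\<sigma>\<close>, and then it is
  eventually equal to \<open>\<sigma> j\<close>; or it returns to arbitrarily late terms of \<open>\<sigma>\<close>, and then \<open>\<sigma> j\<close> is
  the limit of \<open>\<sigma>\<close> itself, contrary to the hypothesis.
\<close>

lemma MCauchy_reindex_dichotomy:
  assumes \<sigma>: "MCauchy \<sigma>" and nolim: "\<And>n. \<not> limitin mtopology \<sigma> (\<sigma> n) sequentially"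
    and \<sigma>k: "MCauchy (\<sigma> \<circ> k)"
  shows "filterlim k at_top sequentially \<or> (\<exists>c. \<forall>\<^sub>F n in sequentially. \<sigma> (k n) = c)"
proof (rule disjCI)
  assume nc: "\<nexists>c. \<forall>\<^sub>F n in sequentially. \<sigma> (k n) = c"
  have M: "\<And>n. \<sigma> n \<in> M" using \<sigma> by (auto simp: MCauchy_def)
  show "filterlim k at_top sequentially"
  proof (rule ccontr)
    assume "\<not> filterlim k at_top sequentially"
    then obtain B where "\<exists>\<^sub>F n in sequentially. \<not> B \<le> k n"
      by (auto simp: filterlim_at_top not_eventually)
    then have "infinite {n. k n < B}"
      by (simp add: frequently_cofinite not_le flip: cofinite_eq_sequentially)
    moreover have "finite (k ` {n. k n < B})"
      by (rule finite_subset[of _ "{..<B}"]) auto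
    ultimately obtain j where "infinite {n \<in> {n. k n < B}. k n = j}"
      using pigeonhole_infinite by fastforce
    then have inf: "infinite {n. k n = j}"
      by (rule contrapos_nn) (auto elim: finite_subset[rotated])
    have "strict_mono (enumerate {n. k n = j})" "\<And>n. k (enumerate {n. k n = j} n) = j"
      using strict_mono_enumerate[OF inf] enumerate_in_set[OF inf] by auto
    then have lim: "limitin mtopology (\<sigma> \<circ> k) (\<sigma> j) sequentially"
      using M by (intro MCauchy_convergent_subsequence[OF \<sigma>k]) (auto simp: o_def)
    \<comment> \<open>A term of \<open>\<sigma>\<close> other than \<open>\<sigma> j\<close> has positive distance from the limit of \<open>\<sigma> \<circ> k\<close>.\<close>
    have avoid: "\<forall>\<^sub>F n in sequentially. \<sigma> (k n) = \<sigma> i \<longrightarrow> \<sigma> i = \<sigma> j" for i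
    proof (cases "\<sigma> i = \<sigma> j")
      case False
      then have "d (\<sigma> i) (\<sigma> j) > 0" using M by simp
      with lim have "\<forall>\<^sub>F n in sequentially. d (\<sigma> (k n)) (\<sigma> j) < d (\<sigma> i) (\<sigma> j)"
        by (auto simp: limitin_metric elim: eventually_mono)
      then show ?thesis by eventually_elim auto
    qed simp
    have esc: "\<exists>\<^sub>F n in sequentially. N \<le> k n" for N
    proof (rule ccontr)
      assume "\<not> (\<exists>\<^sub>F n in sequentially. N \<le> k n)"
      then have "\<forall>\<^sub>F n in sequentially. k n < N"
        by (simp add: not_frequently not_le)
      moreover have "\<forall>\<^sub>F n in sequentially. \<forall>i\<in>{..<N}. \<sigma> (k n) = \<sigma> i \<longrightarrow> \<sigma> i = \<sigma> j"
        using avoid by (intro eventually_ball_finite) auto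
      ultimately have "\<forall>\<^sub>F n in sequentially. \<sigma> (k n) = \<sigma> j"
        by eventually_elim auto
      with nc show False by blast
    qed
    have "limitin mtopology \<sigma> (\<sigma> j) sequentially"
      unfolding limitin_metric
    proof (intro conjI strip)
      fix \<epsilon> :: real assume \<epsilon>: "\<epsilon> > 0"
      then obtain N where N: "\<And>n n'. \<lbrakk>N \<le> n; N \<le> n'\<rbrakk> \<Longrightarrow> d (\<sigma> n) (\<sigma> n') < \<epsilon>/2"
        using \<sigma> unfolding MCauchy_def by (meson half_gt_zero)
      have "\<forall>\<^sub>F n in sequentially. d (\<sigma> (k n)) (\<sigma> j) < \<epsilon>/2"
        using lim \<epsilon> by (auto simp: limitin_metric elim!: allE[of _ "\<epsilon>/2"] elim: eventually_mono)
      then obtain m where m: "N \<le> k m" "d (\<sigma> (k m)) (\<sigma> j) < \<epsilon>/2"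
        using frequently_ex[OF frequently_eventually_conj[OF esc[of N]]] by blast
      have "d (\<sigma> n) (\<sigma> j) < \<epsilon>" if "N \<le> n" for n
        using triangle[OF M[of n] M[of "k m"] M[of j]] N[OF that m(1)] m(2) by linarith
      then show "\<forall>\<^sub>F n in sequentially. \<sigma> n \<in> M \<and> d (\<sigma> n) (\<sigma> j) < \<epsilon>"
        using M by (auto simp: eventually_sequentially)
    qed (rule M)
    with nolim show False by blast
  qed
qed

end

section \<open>Sets on which a function is Cauchy-continuous\<close>

abbreviation Cauchy_in :: "'a metric \<Rightarrow> (nat \<Rightarrow> 'a) \<Rightarrow> bool" where
  "Cauchy_in X \<equiv> Metric_space.MCauchy (mspace X) (mdist X)"

abbreviation tends_to :: "'a metric \<Rightarrow> (nat \<Rightarrow> 'a) \<Rightarrow> 'a \<Rightarrow> bool" where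
  "tends_to X \<sigma> l \<equiv> limitin (Metric_space.mtopology (mspace X) (mdist X)) \<sigma> l sequentially"

text \<open>
  Cauchy sequences of a subspace are the Cauchy sequences of the whole space that lie in it, so the
  restricted metric can be dispensed with.
\<close>

lemma Cauchy_continuity_sets_iff:
  "A \<in> Cauchy_continuity_sets X Y f \<longleftrightarrow> A \<noteq> {} \<and> A \<subseteq> mspace X \<and>
     (\<forall>\<sigma>. range \<sigma> \<subseteq> A \<longrightarrow> Cauchy_in X \<sigma> \<longrightarrow> Cauchy_in Y (f \<circ> \<sigma>))"
  by (auto simp: Cauchy_continuity_sets_def Cauchy_continuous_map_def
      Metric_space.MCauchy_def[OF Metric_space_mspace_mdist]
      Metric_space.MCauchy_def[OF Metric_space.subspace[OF Metric_space_mspace_mdist]])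

lemma Cauchy_continuity_sets_mono:
  assumes "A \<in> Cauchy_continuity_sets X Y f" "B \<noteq> {}" "B \<subseteq> A"
  shows "B \<in> Cauchy_continuity_sets X Y f"
  using assms by (auto simp: Cauchy_continuity_sets_iff subset_iff)

lemma singleton_in_Cauchy_continuity_sets:
  assumes "f \<in> mspace X \<rightarrow> mspace Y" "a \<in> mspace X"
  shows "{a} \<in> Cauchy_continuity_sets X Y f"
proof -
  interpret Y: Metric_space "mspace Y" "mdist Y"
    by (rule Metric_space_mspace_mdist)
  have "f \<circ> \<sigma> = (\<lambda>n. f a)" if "range \<sigma> \<subseteq> {a}" for \<sigma> :: "nat \<Rightarrow> 'a"
  proof
    fix n
    have "\<sigma> n \<in> {a}" using that by blast
    then show "(f \<circ> \<sigma>) n = f a" by simp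
  qed
  with assms show ?thesis
    by (auto simp: Cauchy_continuity_sets_iff)
qed

text \<open>
  A Cauchy sequence in the range of \<open>\<sigma>\<close> is \<open>\<sigma> \<circ> k\<close> for some \<open>k\<close>, so its image is a reindexing of the
  Cauchy sequence \<open>f \<circ> \<sigma>\<close> or eventually constant. Some condition on limits is necessary: if \<open>\<sigma> 0\<close>
  were the limit of the other terms, changing the value of \<open>f\<close> at this one point could leave
  \<open>f \<circ> \<sigma>\<close> Cauchy and yet destroy continuity at \<open>\<sigma> 0\<close>.
\<close>

lemma range_in_Cauchy_continuity_sets:
  assumes f: "f \<in> mspace X \<rightarrow> mspace Y"
    and \<sigma>: "Cauchy_in X \<sigma>" and nolim: "\<And>n. \<not> tends_to X \<sigma> (\<sigma> n)"
    and f\<sigma>: "Cauchy_in Y (f \<circ> \<sigma>)"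
  shows "range \<sigma> \<in> Cauchy_continuity_sets X Y f"
proof -
  interpret X: Metric_space "mspace X" "mdist X"
    by (rule Metric_space_mspace_mdist)
  interpret Y: Metric_space "mspace Y" "mdist Y"
    by (rule Metric_space_mspace_mdist)
  have "Y.MCauchy (f \<circ> \<tau>)" if "range \<tau> \<subseteq> range \<sigma>" and \<tau>: "X.MCauchy \<tau>" for \<tau>
  proof -
    have "\<forall>n. \<exists>m. \<tau> n = \<sigma> m" using that by blast
    then obtain k where "\<And>n. \<tau> n = \<sigma> (k n)" by metis
    then have k: "\<tau> = \<sigma> \<circ> k" by auto
    consider "filterlim k at_top sequentially"
      | c where "\<forall>\<^sub>F n in sequentially. \<sigma> (k n) = c"
      using X.MCauchy_reindex_dichotomy[OF \<sigma> nolim] \<tau> k by auto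
    then show ?thesis
    proof cases
      case 1
      then show ?thesis
        using Y.MCauchy_reindex[OF f\<sigma>] by (simp add: k o_assoc)
    next
      case 2
      then have "\<forall>\<^sub>F n in sequentially. (f \<circ> \<tau>) n = f c"
        by eventually_elim (simp add: k)
      moreover have "range (f \<circ> \<tau>) \<subseteq> mspace Y"
        using \<tau> f by (auto simp: X.MCauchy_def)
      ultimately show ?thesis
        by (rule Y.MCauchy_eventually_const[rotated])
    qed
  qed
  then show ?thesis
    using \<sigma> by (auto simp: Cauchy_continuity_sets_iff X.MCauchy_def)
qed

text \<open>
  Two Cauchy sequences are asymptotic exactly when their interleaving is Cauchy.
\<close>

lemma dist_images_null_on_Cauchy_continuity_set:
  assumes "range \<sigma> \<union> range \<tau> \<in> Cauchy_continuity_sets X Y f"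
    and "Cauchy_in X \<sigma>" "Cauchy_in X \<tau>" "(\<lambda>n. mdist X (\<sigma> n) (\<tau> n)) \<longlonglongrightarrow> 0"
  shows "(\<lambda>n. mdist Y (f (\<sigma> n)) (f (\<tau> n))) \<longlonglongrightarrow> 0"
proof -
  interpret X: Metric_space "mspace X" "mdist X"
    by (rule Metric_space_mspace_mdist)
  interpret Y: Metric_space "mspace Y" "mdist Y"
    by (rule Metric_space_mspace_mdist)
  let ?\<upsilon> = "\<lambda>n. if even n then \<sigma> (n div 2) else \<tau> (n div 2)"
  have "X.MCauchy ?\<upsilon>"
    using assms by (simp add: X.MCauchy_interleaving_gen)
  moreover have "range ?\<upsilon> \<subseteq> range \<sigma> \<union> range \<tau>"
    by auto
  ultimately have "Y.MCauchy (f \<circ> ?\<upsilon>)"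
    using assms(1) unfolding Cauchy_continuity_sets_iff by blast
  also have "f \<circ> ?\<upsilon> = (\<lambda>n. if even n then f (\<sigma> (n div 2)) else f (\<tau> (n div 2)))"
    by auto
  finally show ?thesis
    using Y.MCauchy_interleaving_gen[of "\<lambda>n. f (\<sigma> n)" "\<lambda>n. f (\<tau> n)"] by blast
qed

section \<open>Comparing sequences by TB-regularity and finite unions\<close>

lemma TB_regular_Cauchy_subsequence:
  assumes "TB_regular X Y f" "Cauchy_in X \<sigma>"
  obtains r where "strict_mono r" "Cauchy_in Y (f \<circ> (\<sigma> \<circ> r))"
proof -
  interpret X: Metric_space "mspace X" "mdist X"
    by (rule Metric_space_mspace_mdist)
  interpret Y: Metric_space "mspace Y" "mdist Y"
    by (rule Metric_space_mspace_mdist)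
  have "Y.mtotally_bounded (f ` range \<sigma>)"
    using assms X.mtotally_bounded_cauchy_sequence[OF assms(2)]
    by (simp add: TB_regular_def X.mtotally_bounded_imp_subset)
  moreover have "range (f \<circ> \<sigma>) \<subseteq> f ` range \<sigma>" by auto
  ultimately obtain r :: "nat \<Rightarrow> nat" where "strict_mono r" "Y.MCauchy (f \<circ> \<sigma> \<circ> r)"
    unfolding Y.mtotally_bounded_sequentially by blast
  with that show thesis by (simp add: o_assoc)
qed

text \<open>
  The alternative in the hypothesis covers the two kinds of sequences to be compared later: constant
  ones, where only the value of \<open>f\<close> at a limit point matters, and those that avoid their limit.
\<close>

lemma TB_regular_Cauchy_continuous_on_subsequence:
  assumes f: "f \<in> mspace X \<rightarrow> mspace Y" and TB: "TB_regular X Y f"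
    and \<sigma>: "Cauchy_in X \<sigma>"
    and nolim: "(\<exists>a. \<sigma> = (\<lambda>n. a)) \<or> (\<forall>n. \<not> tends_to X \<sigma> (\<sigma> n))"
  obtains r :: "nat \<Rightarrow> nat" where "strict_mono r" "range (\<sigma> \<circ> r) \<in> Cauchy_continuity_sets X Y f"
proof -
  interpret X: Metric_space "mspace X" "mdist X"
    by (rule Metric_space_mspace_mdist)
  from nolim show thesis
  proof
    assume "\<exists>a. \<sigma> = (\<lambda>n. a)"
    then obtain a where a: "\<sigma> = (\<lambda>n. a)" by blast
    have "{a} \<in> Cauchy_continuity_sets X Y f"
      using \<sigma> by (intro singleton_in_Cauchy_continuity_sets f) (simp add: a)
    then show thesis
      using that[of id] by (simp add: a strict_mono_def)
  next
    assume *: "\<forall>n. \<not> tends_to X \<sigma> (\<sigma> n)"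
    obtain r where r: "strict_mono r" "Cauchy_in Y (f \<circ> (\<sigma> \<circ> r))"
      using TB_regular_Cauchy_subsequence[OF TB \<sigma>] .
    have "\<not> tends_to X (\<sigma> \<circ> r) ((\<sigma> \<circ> r) n)" for n
      using * X.MCauchy_convergent_subsequence[OF \<sigma> r(1)] by auto
    then have "range (\<sigma> \<circ> r) \<in> Cauchy_continuity_sets X Y f"
      using range_in_Cauchy_continuity_sets[OF f X.MCauchy_subsequence[OF r(1) \<sigma>] _ r(2)] by blast
    with r(1) that show thesis by blast
  qed
qed

text \<open>
  Thinning out \<open>\<sigma>\<close> and then \<open>\<tau>\<close> along a common index sequence makes \<open>f\<close> Cauchy-continuous on each
  of the two ranges, hence on their union, where the interleaving argument applies.
\<close>

lemma asymptotic_images_not_apart: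
  assumes f: "f \<in> mspace X \<rightarrow> mspace Y" and TB: "TB_regular X Y f"
    and un: "closed_under_finite_unions (Cauchy_continuity_sets X Y f)"
    and \<sigma>: "Cauchy_in X \<sigma>" "(\<exists>a. \<sigma> = (\<lambda>n. a)) \<or> (\<forall>n. \<not> tends_to X \<sigma> (\<sigma> n))"
    and \<tau>: "Cauchy_in X \<tau>" "(\<exists>a. \<tau> = (\<lambda>n. a)) \<or> (\<forall>n. \<not> tends_to X \<tau> (\<tau> n))"
    and null: "(\<lambda>n. mdist X (\<sigma> n) (\<tau> n)) \<longlonglongrightarrow> 0"
    and \<epsilon>: "\<epsilon> > 0"
  shows "\<exists>n. mdist Y (f (\<sigma> n)) (f (\<tau> n)) < \<epsilon>"
proof -
  interpret X: Metric_space "mspace X" "mdist X"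
    by (rule Metric_space_mspace_mdist)
  let ?B = "Cauchy_continuity_sets X Y f"
  obtain r :: "nat \<Rightarrow> nat" where r: "strict_mono r" "range (\<sigma> \<circ> r) \<in> ?B"
    using TB_regular_Cauchy_continuous_on_subsequence[OF f TB \<sigma>] by blast
  have \<tau>r: "X.MCauchy (\<tau> \<circ> r)"
    by (rule X.MCauchy_subsequence[OF r(1) \<tau>(1)])
  have "(\<exists>a. \<tau> \<circ> r = (\<lambda>n. a)) \<or> (\<forall>n. \<not> tends_to X (\<tau> \<circ> r) ((\<tau> \<circ> r) n))"
    using \<tau>(2)
  proof
    assume "\<exists>a. \<tau> = (\<lambda>n. a)"
    then show ?thesis by (auto simp: o_def)
  next
    assume "\<forall>n. \<not> tends_to X \<tau> (\<tau> n)"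
    then show ?thesis
      using X.MCauchy_convergent_subsequence[OF \<tau>(1) r(1)] by auto
  qed
  then obtain s :: "nat \<Rightarrow> nat" where s: "strict_mono s" "range (\<tau> \<circ> r \<circ> s) \<in> ?B"
    using TB_regular_Cauchy_continuous_on_subsequence[OF f TB \<tau>r] by blast
  define t where "t = r \<circ> s"
  have t: "strict_mono t"
    unfolding t_def using r s by (intro strict_mono_o)
  have "range (\<sigma> \<circ> t) \<in> ?B"
    by (rule Cauchy_continuity_sets_mono[OF r(2)]) (auto simp: t_def)
  moreover have "range (\<tau> \<circ> t) \<in> ?B"
    using s(2) by (simp add: t_def o_assoc)
  ultimately have "range (\<sigma> \<circ> t) \<union> range (\<tau> \<circ> t) \<in> ?B"
    using un[unfolded closed_under_finite_unions_def, rule_format,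
        of "{range (\<sigma> \<circ> t), range (\<tau> \<circ> t)}"] by simp
  moreover have "(\<lambda>n. mdist X ((\<sigma> \<circ> t) n) ((\<tau> \<circ> t) n)) \<longlonglongrightarrow> 0"
    using LIMSEQ_subseq_LIMSEQ[OF null t] by (simp add: o_def)
  ultimately have "(\<lambda>n. mdist Y (f ((\<sigma> \<circ> t) n)) (f ((\<tau> \<circ> t) n))) \<longlonglongrightarrow> 0"
    by (rule dist_images_null_on_Cauchy_continuity_set
        [OF _ X.MCauchy_subsequence[OF t \<sigma>(1)] X.MCauchy_subsequence[OF t \<tau>(1)]])
  then have "\<forall>\<^sub>F n in sequentially. mdist Y (f ((\<sigma> \<circ> t) n)) (f ((\<tau> \<circ> t) n)) < \<epsilon>"
    by (rule order_tendstoD(2)[OF _ \<epsilon>])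
  then obtain n where "mdist Y (f ((\<sigma> \<circ> t) n)) (f ((\<tau> \<circ> t) n)) < \<epsilon>"
    using eventually_happens'[OF sequentially_bot] by blast
  then show ?thesis by auto
qed

lemma Cauchy_continuous_map_if_TB_regular_closed_unions:
  assumes f: "f \<in> mspace X \<rightarrow> mspace Y" and TB: "TB_regular X Y f"
    and un: "closed_under_finite_unions (Cauchy_continuity_sets X Y f)"
  shows "Cauchy_continuous_map X Y f"
  unfolding Cauchy_continuous_map_def
proof (intro strip)
  interpret X: Metric_space "mspace X" "mdist X"
    by (rule Metric_space_mspace_mdist)
  interpret Y: Metric_space "mspace Y" "mdist Y"
    by (rule Metric_space_mspace_mdist)
  fix \<sigma> assume \<sigma>: "X.MCauchy \<sigma>"
  then have \<sigma>M: "\<sigma> n \<in> mspace X" for n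
    by (auto simp: X.MCauchy_def)
  have f\<sigma>M: "f (\<sigma> n) \<in> mspace Y" for n
    using f \<sigma>M by blast
  have ge_self: "filterlim k at_top sequentially" if "\<And>n. n \<le> k n" for k :: "nat \<Rightarrow> nat"
    by (rule filterlim_at_top_mono[OF filterlim_ident]) (simp add: that)
  show "Y.MCauchy (f \<circ> \<sigma>)"
  proof (cases "\<exists>a. tends_to X \<sigma> a")
    case True
    then obtain a where a: "tends_to X \<sigma> a" by blast
    then have aM: "a \<in> mspace X" by (simp add: X.limitin_mspace)
    have "tends_to Y (f \<circ> \<sigma>) (f a)"
    proof (rule ccontr)
      assume "\<not> tends_to Y (f \<circ> \<sigma>) (f a)"
      then obtain \<epsilon> where \<epsilon>: "\<epsilon> > 0" "\<forall>N. \<exists>n\<ge>N. \<epsilon> \<le> mdist Y (f (\<sigma> n)) (f a)"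
        using f f\<sigma>M aM by (force simp: Y.limit_metric_sequentially not_less)
      then obtain p where p: "\<And>n. n \<le> p n" "\<And>n. \<epsilon> \<le> mdist Y (f (\<sigma> (p n))) (f a)"
        by metis
      have p': "filterlim p at_top sequentially" by (rule ge_self[OF p(1)])
      have lim: "tends_to X (\<sigma> \<circ> p) a"
        unfolding X.limitin_metric
      proof (intro conjI strip aM)
        fix \<delta> :: real assume "\<delta> > 0"
        with a have "\<forall>\<^sub>F n in sequentially. \<sigma> n \<in> mspace X \<and> mdist X (\<sigma> n) a < \<delta>"
          by (simp add: X.limitin_metric)
        then show "\<forall>\<^sub>F n in sequentially.
            (\<sigma> \<circ> p) n \<in> mspace X \<and> mdist X ((\<sigma> \<circ> p) n) a < \<delta>"
          by (auto dest: eventually_compose_filterlim[OF _ p'])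
      qed
      have "\<sigma> (p n) \<noteq> a" for n
        using p(2)[of n] \<epsilon>(1) f\<sigma>M[of "p n"] by auto
      then have "\<not> tends_to X (\<sigma> \<circ> p) ((\<sigma> \<circ> p) n)" for n
        using X.limitin_metric_unique[OF _ lim] by fastforce
      then have "\<exists>n. mdist Y (f ((\<sigma> \<circ> p) n)) (f a) < \<epsilon>"
        using lim aM \<epsilon>(1)
        by (intro asymptotic_images_not_apart[OF f TB un X.MCauchy_reindex[OF \<sigma> p']])
          (auto simp: X.limitin_metric_dist_null)
      with p(2) show False by (auto simp flip: not_less)
    qed
    then show ?thesis
      using f\<sigma>M by (intro Y.convergent_imp_MCauchy) auto
  next
    case False
    show ?thesis
    proof (rule ccontr)
      assume "\<not> Y.MCauchy (f \<circ> \<sigma>)"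
      then obtain \<epsilon> where \<epsilon>: "\<epsilon> > 0"
          "\<forall>N. \<exists>m n. N \<le> m \<and> N \<le> n \<and> \<epsilon> \<le> mdist Y (f (\<sigma> m)) (f (\<sigma> n))"
        using f\<sigma>M by (force simp: Y.MCauchy_def not_less)
      then obtain p q where pq: "\<And>n. n \<le> p n" "\<And>n. n \<le> q n"
          "\<And>n. \<epsilon> \<le> mdist Y (f (\<sigma> (p n))) (f (\<sigma> (q n)))"
        by metis
      have p: "filterlim p at_top sequentially" and q: "filterlim q at_top sequentially"
        using ge_self pq by blast+
      have "\<not> tends_to X (\<sigma> \<circ> k) l" if "filterlim k at_top sequentially" for k l
        using False X.MCauchy_reindex_limit[OF \<sigma> that] by blast
      then have "\<exists>n. mdist Y (f ((\<sigma> \<circ> p) n)) (f ((\<sigma> \<circ> q) n)) < \<epsilon>"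
        using X.MCauchy_reindex_dist[OF \<sigma> p q] p q \<epsilon>(1)
        by (intro asymptotic_images_not_apart[OF f TB un] X.MCauchy_reindex[OF \<sigma>])
          (auto simp: o_def)
      with pq(3) show False by (auto simp flip: not_less)
    qed
  qed
qed

section \<open>The characterisation\<close>

lemma Cauchy_continuity_sets_of_Cauchy_continuous_map:
  assumes "Cauchy_continuous_map X Y f"
  shows "Cauchy_continuity_sets X Y f = {A. A \<noteq> {} \<and> A \<subseteq> mspace X}"
  using Cauchy_continuous_map_from_submetric[OF assms]
  by (auto simp: Cauchy_continuity_sets_def)

lemma bornology_on_nonempty_subsets: "bornology_on S {A. A \<noteq> {} \<and> A \<subseteq> S}"
  unfolding bornology_on_def closed_under_finite_unions_def by blast

theorem theorem6:
  fixes X :: "'a metric" and Y :: "'b metric" and f :: "'a \<Rightarrow> 'b"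
  assumes "f \<in> mspace X \<rightarrow> mspace Y"
  shows "(Cauchy_continuous_map X Y f \<longleftrightarrow>
            TB_regular X Y f \<and> closed_under_finite_unions (Cauchy_continuity_sets X Y f)) \<and>
         (Cauchy_continuous_map X Y f \<longleftrightarrow>
            TB_regular X Y f \<and> bornology_on (mspace X) (Cauchy_continuity_sets X Y f))"
proof -
  have "TB_regular X Y f \<and> bornology_on (mspace X) (Cauchy_continuity_sets X Y f)"
    if "Cauchy_continuous_map X Y f"
    using mtotally_bounded_Cauchy_continuous_image[OF that]
    by (simp add: TB_regular_def Cauchy_continuity_sets_of_Cauchy_continuous_map[OF that]
        bornology_on_nonempty_subsets)
  moreover have "closed_under_finite_unions (Cauchy_continuity_sets X Y f)"
    if "bornology_on (mspace X) (Cauchy_continuity_sets X Y f)"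
    using that by (simp add: bornology_on_def)
  ultimately show ?thesis
    using Cauchy_continuous_map_if_TB_regular_closed_unions[OF assms] by blast
qed

end
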